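(* Let $q$ be a query, $\mathcal{I}$ a finite set of candidate indexes, and $c(q,\cdot)$ a what-if cost function on subsets of $\mathcal{I}$ that is non-negative, monotone and submodular (as defined in the context). Run budget-aware greedy search on the single-query workload $\{q\}$ with at most $K$ indexes and a budget of $B$ what-if calls, maintaining the MCI upper bounds $u(q,z)$ as described in the context. Let $C_B^*=\{z_1,\dots,z_k\}$, $k\le K$, be the configuration returned, where $z_i$ is the index selected at greedy step $i$, and let $u^{(i)}(q,z_i)$ be the value of $u(q,z_i)$ after greedy step $i$ of this run. Let $t<B$ be a time of this run (i.e., a moment when $t$ what-if calls have been made), and let $z'_1,\dots,z'_K$ be the indexes selected by the simulated greedy search at time $t$, with $u^{(j)}(q,z'_j)$ the value of the MCI upper bound of $z'_j$ used at step $j$ of the simulated greedy search. Then $$\sum_{j=1}^K u^{(j)}(q, z'_j)\;\geq\;\sum_{i=1}^k u^{(i)}(q,z_i).$$ As a result, $$L(q, C_B^* )=c(q,\emptyset)-\sum_{j=1}^K u^{(j)}(q, z'_j)$$ is a lower bound of the what-if cost of $C_B^*$, i.e., $L(q,C_B^* )\le c(q, C_B^* )$.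
   Context: **Costs.** A configuration is a subset $C\subseteq\mathcal{I}$. The what-if cost $c(q,C)\ge 0$ is a real number. Standing assumptions: (Monotonicity) if $C_1\subseteq C_2$ then $c(q,C_2)\le c(q,C_1)$. (Submodularity) if $X\subseteq Y$ and $z\notin Y$ then $c(q,Y)-c(q,Y\cup\{z\})\le c(q,X)-c(q,X\cup\{z\})$. Write $\Delta(q,C)=c(q,\emptyset)-c(q,C)$ (cost improvement) and $\delta(q,z,C)=c(q,C)-c(q,C\cup\{z\})$ (marginal cost improvement, MCI). $\Omega_q$ denotes the best possible configuration for $q$ when all candidate indexes are available, so $c(q,\Omega_q)=\min_{C\subseteq\mathcal{I}}c(q,C)$. The values $c(q,\emptyset)$ and $c(q,\Omega_q)$ are known. **Budget-aware greedy search.** A what-if call on $C$ reveals $c(q,C)$; at most $B$ calls may be made, and they are allocated on a first-come-first-serve basis. The cost $c(q,C)$ is *available* if a what-if call on $C$ has been made (or $C=\emptyset$). If no what-if call is made on $C$, its cost is approximated by the derived cost $d(q,C)=\min_{S\subseteq C} c(q,S)$, the minimum being over subsets $S$ of $C$ for which $c(q,S)$ is available. Start with $C_0=\emptyset$. In greedy step $i$, each not yet selected $z\in\mathcal{I}$ is evaluated via the cost of $C_{i-1}\cup\{z\}$ (by a what-if call if budget remains, otherwise by derived cost); the index $z_i$ giving the smallest cost is selected and $C_i=C_{i-1}\cup\{z_i\}$. The search stops when $K$ indexes have been selected or no remaining index lowers the cost. **Maintenance of MCI upper bounds.** For each index $z$ not yet selected by the greedy search: (a) initialize $u(q,z)=\min\{c(q,\emptyset),\Delta(q,\Omega_q)\}$;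 (b) during greedy step $k$ ($1\le k\le K$), set $u(q,z)=c(q,C_{k-1})-c(q,C_{k-1}\cup\{z\})=\delta(q,z,C_{k-1})$ if both $c(q,C_{k-1})$ and $c(q,C_{k-1}\cup\{z\})$ are available. After an index has been selected, its value $u(q,z)$ is no longer updated. **Simulated greedy search at time $t$.** Using the values $u(q,z)$ current at the moment when $t$ what-if calls have been made (no further what-if calls are made, so these values do not change during the simulation), start from the empty configuration and repeatedly, at step $j$, select from the candidate indexes in $\mathcal{I}$ not yet chosen by the simulation the index $z'_j$ with the maximum value $u^{(j)}(q,z'_j)$ of $u(q,\cdot)$, provided this value is $>0$; stop after $K$ indexes or when no remaining index has positive value. If only $l<K$ indexes are selected, all remaining indexes have $u(q,z)=0$, and by convention the terms $u^{(j)}(q,z'_j)$ with $l<j\le K$ are $0$. *)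

theory Defs
  imports Complex_Main
begin

text \<open>
  All notions are parametrised by the cost function \<open>f\<close> of a single query, which
  is to be read as \<open>c(q, \<cdot>)\<close>; configurations are the subsets of the set \<open>I\<close> of
  candidate indexes.
\<close>

definition submodular_cost :: "'i set \<Rightarrow> ('i set \<Rightarrow> real) \<Rightarrow> bool" where
  "submodular_cost I f \<longleftrightarrow>
     (\<forall>X Y z. X \<subseteq> Y \<longrightarrow> Y \<subseteq> I \<longrightarrow> z \<in> I \<longrightarrow> z \<notin> Y \<longrightarrow>
        f Y - f (insert z Y) \<le> f X - f (insert z X))"

definition best_configuration :: "'i set \<Rightarrow> ('i set \<Rightarrow> real) \<Rightarrow> 'i set" where
  "best_configuration I f = arg_min_on f (Pow I)"

definition cost_improvement :: "('i set \<Rightarrow> real) \<Rightarrow> 'i set \<Rightarrow> real" where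
  "cost_improvement f C = f {} - f C"

definition marginal_improvement :: "('i set \<Rightarrow> real) \<Rightarrow> 'i \<Rightarrow> 'i set \<Rightarrow> real" where
  "marginal_improvement f z C = f C - f (insert z C)"

text \<open>
  A state of the budget-aware greedy search: the indexes selected so far in the order
  of selection, the indexes already evaluated in the current greedy step, the
  configurations on which a what-if call has been made (in the order of the calls),
  and the current values \<open>u(q, z)\<close>. In a state with \<open>k - 1\<close> selected indexes the
  search is performing greedy step \<open>k\<close>, and \<open>C\<^sub>k\<^sub>-\<^sub>1\<close> is \<open>set (selected s)\<close>.
\<close>

record 'i search_state =
  selected :: "'i list"
  evaluated :: "'i set"
  calls :: "'i set list"
  bound :: "'i \<Rightarrow> real"

definition available :: "'i search_state \<Rightarrow> 'i set \<Rightarrow> bool" where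
  "available s C \<longleftrightarrow> C = {} \<or> C \<in> set (calls s)"

definition derived_cost :: "('i set \<Rightarrow> real) \<Rightarrow> 'i search_state \<Rightarrow> 'i set \<Rightarrow> real" where
  "derived_cost f s C = Min (f ` {S. S \<subseteq> C \<and> available s S})"

definition search_cost :: "('i set \<Rightarrow> real) \<Rightarrow> 'i search_state \<Rightarrow> 'i set \<Rightarrow> real" where
  "search_cost f s C = (if available s C then f C else derived_cost f s C)"

definition initial_state :: "'i set \<Rightarrow> ('i set \<Rightarrow> real) \<Rightarrow> 'i search_state" where
  "initial_state I f =
     \<lparr>selected = [], evaluated = {}, calls = [],
      bound = (\<lambda>z. min (f {}) (cost_improvement f (best_configuration I f)))\<rparr>"

definition update_bound :: "('i set \<Rightarrow> real) \<Rightarrow> 'i \<Rightarrow> 'i search_state \<Rightarrow> 'i search_state" where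
  "update_bound f z s =
     (let C = set (selected s) in
      if available s C \<and> available s (insert z C)
      then s\<lparr>bound := (bound s)(z := marginal_improvement f z C)\<rparr>
      else s)"

text \<open>
  The order in which the indexes are evaluated within a greedy step and the choice
  among several minimisers are left open. A what-if call is made exactly when the
  budget is not yet used up, and the bound of the evaluated index is updated
  together with the call.
\<close>

inductive greedy_step ::
  "'i set \<Rightarrow> ('i set \<Rightarrow> real) \<Rightarrow> nat \<Rightarrow> nat \<Rightarrow> 'i search_state \<Rightarrow> 'i search_state \<Rightarrow> bool"
  for I :: "'i set" and f :: "'i set \<Rightarrow> real" and K B :: nat where
  evaluate_what_if:
    "\<lbrakk>length (selected s) < K; z \<in> I - set (selected s); z \<notin> evaluated s;
      length (calls s) < B\<rbrakk> \<Longrightarrow>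
     greedy_step I f K B s
       (update_bound f z
         (s\<lparr>evaluated := insert z (evaluated s),
            calls := calls s @ [insert z (set (selected s))]\<rparr>))"
| evaluate_derived:
    "\<lbrakk>length (selected s) < K; z \<in> I - set (selected s); z \<notin> evaluated s;
      length (calls s) \<ge> B\<rbrakk> \<Longrightarrow>
     greedy_step I f K B s
       (update_bound f z (s\<lparr>evaluated := insert z (evaluated s)\<rparr>))"
| select:
    "\<lbrakk>length (selected s) < K; evaluated s = I - set (selected s);
      z \<in> I - set (selected s);
      \<forall>y \<in> I - set (selected s).
        search_cost f s (insert z (set (selected s)))
          \<le> search_cost f s (insert y (set (selected s)));
      search_cost f s (insert z (set (selected s))) < search_cost f s (set (selected s))\<rbrakk> \<Longrightarrow>
     greedy_step I f K B s (s\<lparr>selected := selected s @ [z], evaluated := {}\<rparr>)"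

definition search_finished ::
  "'i set \<Rightarrow> ('i set \<Rightarrow> real) \<Rightarrow> nat \<Rightarrow> 'i search_state \<Rightarrow> bool" where
  "search_finished I f K s \<longleftrightarrow>
     length (selected s) = K \<or>
     (evaluated s = I - set (selected s) \<and>
      (\<forall>z \<in> I - set (selected s).
         search_cost f s (insert z (set (selected s))) \<ge> search_cost f s (set (selected s))))"

definition greedy_run ::
  "'i set \<Rightarrow> ('i set \<Rightarrow> real) \<Rightarrow> nat \<Rightarrow> nat \<Rightarrow> 'i search_state list \<Rightarrow> bool" where
  "greedy_run I f K B \<sigma> \<longleftrightarrow>
     \<sigma> \<noteq> [] \<and> hd \<sigma> = initial_state I f \<and> successively (greedy_step I f K B) \<sigma> \<and>
     search_finished I f K (last \<sigma>)"

definition run_selected :: "'i search_state list \<Rightarrow> 'i list" where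
  "run_selected \<sigma> = selected (last \<sigma>)"

definition returned_configuration :: "'i search_state list \<Rightarrow> 'i set" where
  "returned_configuration \<sigma> = set (run_selected \<sigma>)"

text \<open>
  The state after greedy step \<open>i\<close> is the first one with \<open>i\<close> selected indexes. List
  positions start at 0, so \<open>z\<^sub>i\<close> is found at position \<open>i - 1\<close>.
\<close>

definition state_after_step :: "'i search_state list \<Rightarrow> nat \<Rightarrow> 'i search_state" where
  "state_after_step \<sigma> i = the (List.find (\<lambda>s. length (selected s) = i) \<sigma>)"

definition run_bound :: "'i search_state list \<Rightarrow> nat \<Rightarrow> real" where
  "run_bound \<sigma> i = bound (state_after_step \<sigma> i) (run_selected \<sigma> ! (i - 1))"

text \<open>
  \<open>simulated_greedy I K u zs\<close>: the simulated greedy search with the fixed values \<open>u\<close>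
  may select exactly the indexes \<open>zs\<close>, in this order, and then stop.
\<close>

definition simulated_greedy :: "'i set \<Rightarrow> nat \<Rightarrow> ('i \<Rightarrow> real) \<Rightarrow> 'i list \<Rightarrow> bool" where
  "simulated_greedy I K u zs \<longleftrightarrow>
     length zs \<le> K \<and>
     (\<forall>j < length zs.
        zs ! j \<in> I - set (take j zs) \<and> u (zs ! j) > 0 \<and>
        (\<forall>y \<in> I - set (take j zs). u y \<le> u (zs ! j))) \<and>
     (length zs = K \<or> (\<forall>y \<in> I - set zs. \<not> u y > 0))"

definition simulated_bound :: "('i \<Rightarrow> real) \<Rightarrow> 'i list \<Rightarrow> nat \<Rightarrow> real" where
  "simulated_bound u zs j = (if j \<le> length zs then u (zs ! (j - 1)) else 0)"

definition cost_lower_bound ::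
  "('i set \<Rightarrow> real) \<Rightarrow> nat \<Rightarrow> ('i \<Rightarrow> real) \<Rightarrow> 'i list \<Rightarrow> real" where
  "cost_lower_bound f K u zs = f {} - (\<Sum>j = 1..K. simulated_bound u zs j)"

end

theory Submission
  imports Defs "HOL-Library.Sublist"
begin

text \<open>
  By submodularity every bound \<open>u(q, z)\<close> of an unselected index dominates the marginal
  improvement of \<open>z\<close> at the current configuration, so the bounds only decrease during a
  run, and they are frozen on selection. Telescoping the marginal improvements, the final
  bounds of the selected indexes sum to at least \<open>c(q, \<emptyset>) - c(q, C\<^sub>B\<^sup>*)\<close>. The bounds
  at any earlier time are at least the final ones, and the simulated search collects the
  \<open>K\<close> largest of these nonnegative values, so its sum dominates that of any at most \<open>K\<close>
  indexes.
\<close>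

subsection \<open>The simulated search\<close>

lemma simulated_greedy_distinct:
  assumes "simulated_greedy I K u zs"
  shows "distinct zs"
proof -
  have fresh: "zs ! j \<notin> set (take j zs)" if "j < length zs" for j
    using assms that unfolding simulated_greedy_def by blast
  have "zs ! i \<noteq> zs ! j" if "i < j" "j < length zs" for i j
    using fresh[of j] that by (auto simp: in_set_conv_nth)
  then show ?thesis
    by (metis distinct_conv_nth linorder_neqE_nat)
qed

lemma simulated_greedy_subset:
  assumes "simulated_greedy I K u zs"
  shows "set zs \<subseteq> I"
proof
  fix z assume "z \<in> set zs"
  then obtain j where "j < length zs" "z = zs ! j"
    by (auto simp: in_set_conv_nth)
  then show "z \<in> I"
    using assms unfolding simulated_greedy_def by blast
qed

text \<open>An index that is never chosen remains a candidate at every step, so it lost the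
  comparison at the step that chose \<open>z\<close>.\<close>

lemma simulated_greedy_top:
  assumes "simulated_greedy I K u zs" "z \<in> set zs" "y \<in> I - set zs"
  shows "u y \<le> u z"
proof -
  obtain j where "j < length zs" "z = zs ! j"
    using assms(2) by (auto simp: in_set_conv_nth)
  moreover have "y \<in> I - set (take j zs)"
    using assms(3) set_take_subset[of j zs] by blast
  ultimately show ?thesis
    using assms(1) unfolding simulated_greedy_def by blast
qed

lemma sum_simulated_bound:
  assumes "simulated_greedy I K u zs"
  shows "(\<Sum>j = 1..K. simulated_bound u zs j) = sum u (set zs)"
proof -
  have "length zs \<le> K"
    using assms unfolding simulated_greedy_def by blast
  then have "(\<Sum>j = 1..K. simulated_bound u zs j) = (\<Sum>j = 1..length zs. simulated_bound u zs j)"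
    by (intro sum.mono_neutral_right) (auto simp: simulated_bound_def)
  also have "\<dots> = (\<Sum>j<length zs. u (zs ! j))"
    by (simp add: simulated_bound_def sum.atLeast1_atMost_eq)
  also have "\<dots> = sum u (set zs)"
    using simulated_greedy_distinct[OF assms]
    by (simp add: sum.distinct_set_conv_list sum_list_sum_nth atLeast0LessThan)
  finally show ?thesis .
qed

text \<open>Exchange argument: the indexes common to \<open>S\<close> and \<open>zs\<close> cancel,
  and what \<open>S\<close> has beyond \<open>zs\<close> is weighed against what \<open>zs\<close>
  has beyond \<open>S\<close>.\<close>

lemma sum_le_sum_simulated_bound:
  assumes sim: "simulated_greedy I K u zs" and nonneg: "\<And>y. y \<in> I \<Longrightarrow> 0 \<le> u y"
    and S: "finite S" "S \<subseteq> I" "card S \<le> K"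
  shows "sum u S \<le> (\<Sum>j = 1..K. simulated_bound u zs j)"
proof -
  let ?Z = "set zs"
  have nonnegZ: "0 \<le> u z" if "z \<in> ?Z" for z
    using nonneg simulated_greedy_subset[OF sim] that by blast
  have "sum u (S - ?Z) \<le> sum u (?Z - S)"
  proof (cases "length zs = K")
    case True
    then have "card S \<le> card ?Z"
      using S(3) simulated_greedy_distinct[OF sim] by (simp add: distinct_card)
    then have "card (S - ?Z) \<le> card (?Z - S)"
      using S(1) card_le_sym_Diff[of S ?Z] by simp
    \<comment> \<open>With all \<open>K\<close> places filled, each index of \<open>S\<close> that
      the simulation missed can be paired with its own chosen index outside \<open>S\<close>, whose
      value is at least as large.\<close>
    then obtain h where h: "inj_on h (S - ?Z)" "h ` (S - ?Z) \<subseteq> ?Z - S"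
      using S(1) inj_on_iff_card_le[of "S - ?Z" "?Z - S"] by auto
    have "sum u (S - ?Z) \<le> (\<Sum>y\<in>S - ?Z. u (h y))"
      using h(2) S(2) by (intro sum_mono simulated_greedy_top[OF sim]) auto
    also have "\<dots> = sum u (h ` (S - ?Z))"
      using h(1) by (simp add: sum.reindex)
    also have "\<dots> \<le> sum u (?Z - S)"
      using h(2) by (intro sum_mono2) (auto intro: nonnegZ)
    finally show ?thesis .
  next
    case False
    \<comment> \<open>Fewer than \<open>K\<close> choices mean that the simulation ran out of
      positive values, so the missed indexes contribute nothing positive.\<close>
    then have "\<forall>y \<in> I - ?Z. \<not> 0 < u y"
      using sim unfolding simulated_greedy_def by blast
    then have "u y \<le> 0" if "y \<in> S - ?Z" for y
      using S(2) that by (auto simp: not_less)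
    then have "sum u (S - ?Z) \<le> 0"
      by (rule sum_nonpos)
    also have "0 \<le> sum u (?Z - S)"
      by (rule sum_nonneg) (auto intro: nonnegZ)
    finally show ?thesis .
  qed
  moreover have "sum u S = sum u (S \<inter> ?Z) + sum u (S - ?Z)"
    by (rule sum.Int_Diff) fact
  moreover have "sum u ?Z = sum u (S \<inter> ?Z) + sum u (?Z - S)"
    using sum.Int_Diff[of ?Z u S] by (simp add: Int_commute)
  ultimately show ?thesis
    unfolding sum_simulated_bound[OF sim] by linarith
qed

subsection \<open>Invariants of the budget-aware search\<close>

definition search_invariant ::
  "'i set \<Rightarrow> ('i set \<Rightarrow> real) \<Rightarrow> nat \<Rightarrow> 'i search_state \<Rightarrow> bool" where
  "search_invariant I f K s \<longleftrightarrow>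
     distinct (selected s) \<and> set (selected s) \<subseteq> I \<and> length (selected s) \<le> K \<and>
     (\<forall>z \<in> I. 0 \<le> bound s z) \<and>
     (\<forall>z \<in> I - set (selected s). marginal_improvement f z (set (selected s)) \<le> bound s z) \<and>
     f {} - f (set (selected s)) \<le> sum (bound s) (set (selected s))"

lemma marginal_improvement_nonneg:
  assumes "antimono_on (Pow I) f" "C \<subseteq> I" "z \<in> I"
  shows "0 \<le> marginal_improvement f z C"
  using assms unfolding marginal_improvement_def
  by (auto dest: monotone_onD[where x = C and y = "insert z C"])

text \<open>Both entries of the initial minimum dominate every improvement over the empty
  configuration: \<open>f {}\<close> because costs are nonnegative, the other because the best
  configuration has minimal cost.\<close>

lemma search_invariant_initial:
  assumes "finite I" "\<forall>C \<subseteq> I. f C \<ge> 0"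
  shows "search_invariant I f K (initial_state I f)"
proof -
  have best: "f (best_configuration I f) \<le> f C" if "C \<subseteq> I" for C
    unfolding best_configuration_def using assms(1) that
    by (intro arg_min_least) auto
  show ?thesis
    using assms(2) best[of "{}"] best
    by (auto simp: search_invariant_def initial_state_def marginal_improvement_def
        cost_improvement_def)
qed

lemma update_bound_simps [simp]:
  "selected (update_bound f z s) = selected s"
  "bound (update_bound f z s) =
     (if available s (set (selected s)) \<and> available s (insert z (set (selected s)))
      then (bound s)(z := marginal_improvement f z (set (selected s))) else bound s)"
  by (auto simp: update_bound_def Let_def)

text \<open>An overwritten bound equals the current marginal improvement, so domination holds with
  equality; \<open>z\<close> is unselected, so the sum over selected indexes is untouched. The state
  \<open>s'\<close> absorbs changes to \<open>evaluated\<close> and \<open>calls\<close>, which the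
  invariant ignores.\<close>

lemma search_invariant_update_bound:
  assumes mono: "antimono_on (Pow I) f" and inv: "search_invariant I f K s"
    and z: "z \<in> I - set (selected s)"
    and s': "selected s' = selected s" "bound s' = bound s"
  shows "search_invariant I f K (update_bound f z s')"
proof -
  have "sum ((bound s)(z := a)) (set (selected s)) = sum (bound s) (set (selected s))" for a
    using z by (intro sum.cong) auto
  moreover have "0 \<le> marginal_improvement f z (set (selected s))"
    using inv z by (intro marginal_improvement_nonneg[OF mono]) (auto simp: search_invariant_def)
  ultimately show ?thesis
    using inv s' by (auto simp: search_invariant_def)
qed

lemma search_invariant_step:
  assumes "antimono_on (Pow I) f" "submodular_cost I f"
    and "greedy_step I f K B s s'" "search_invariant I f K s"
  shows "search_invariant I f K s'"
  using assms(3,4)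
proof cases
  case (evaluate_what_if z)
  show ?thesis
    unfolding evaluate_what_if(1)
    by (rule search_invariant_update_bound[OF assms(1,4)]) (use evaluate_what_if in auto)
next
  case (evaluate_derived z)
  show ?thesis
    unfolding evaluate_derived(1)
    by (rule search_invariant_update_bound[OF assms(1,4)]) (use evaluate_derived in auto)
next
  case (select z)
  let ?C = "set (selected s)"
  \<comment> \<open>Selection enlarges the configuration, and submodularity makes the marginal
    improvements of the remaining indexes shrink, so their old bounds still dominate.\<close>
  have "marginal_improvement f y (insert z ?C) \<le> bound s y" if "y \<in> I - insert z ?C" for y
  proof -
    have "insert z ?C \<subseteq> I"
      using select assms(4) by (auto simp: search_invariant_def)
    then have "marginal_improvement f y (insert z ?C) \<le> marginal_improvement f y ?C"
      using assms(2)[unfolded submodular_cost_def, rule_format, of ?C "insert z ?C" y] that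
      by (auto simp: marginal_improvement_def)
    also have "\<dots> \<le> bound s y"
      using assms(4) that by (auto simp: search_invariant_def)
    finally show ?thesis .
  qed
  \<comment> \<open>This is the new term of the telescoping sum, paid for by the bound of the index
    just selected.\<close>
  moreover have "f ?C - f (insert z ?C) \<le> bound s z"
    using select assms(4) by (auto simp: search_invariant_def marginal_improvement_def)
  ultimately show ?thesis
    using select assms(4) by (auto simp: search_invariant_def)
qed

text \<open>A bound changes only by being set to the current marginal improvement, which the
  invariant places below the old value.\<close>

lemma bound_step_le:
  assumes "greedy_step I f K B s s'" "search_invariant I f K s" "z \<in> I"
  shows "bound s' z \<le> bound s z"
  using assms by cases (auto simp: search_invariant_def)

lemma selected_step_cases:
  assumes "greedy_step I f K B s s'"
  shows "selected s' = selected s \<or> (\<exists>z. selected s' = selected s @ [z])"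
  using assms by cases auto

lemma bound_step_selected:
  assumes "greedy_step I f K B s s'" "z \<in> set (selected s)"
  shows "bound s' z = bound s z"
  using assms by cases auto

lemma search_invariant_steps:
  assumes "antimono_on (Pow I) f" "submodular_cost I f"
    and "(greedy_step I f K B)\<^sup>*\<^sup>* s s'" "search_invariant I f K s"
  shows "search_invariant I f K s'"
  using assms(3,4) by induction (auto intro: search_invariant_step[OF assms(1,2)])

lemma bound_steps_le:
  assumes "antimono_on (Pow I) f" "submodular_cost I f"
    and "(greedy_step I f K B)\<^sup>*\<^sup>* s s'" "search_invariant I f K s" "z \<in> I"
  shows "bound s' z \<le> bound s z"
  using assms(3)
proof induction
  case (step s' s'')
  have "bound s'' z \<le> bound s' z"
    using step(2) search_invariant_steps[OF assms(1,2) step(1) assms(4)] assms(5)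
    by (rule bound_step_le)
  with step.IH show ?case
    by simp
qed simp

lemma selected_steps_prefix:
  assumes "(greedy_step I f K B)\<^sup>*\<^sup>* s s'"
  shows "prefix (selected s) (selected s')"
  using assms by induction (auto dest!: selected_step_cases simp: prefix_def)

lemma bound_steps_selected:
  assumes "(greedy_step I f K B)\<^sup>*\<^sup>* s s'" "z \<in> set (selected s)"
  shows "bound s' z = bound s z"
  using assms
proof induction
  case (step s' s'')
  have "z \<in> set (selected s')"
    using set_mono_prefix[OF selected_steps_prefix[OF step(1)]] step.prems by blast
  with step show ?case
    by (simp add: bound_step_selected)
qed simp

subsection \<open>Runs\<close>

lemma successively_imp_rtranclp:
  assumes "successively R xs" "x \<in> set xs"
  shows "R\<^sup>*\<^sup>* (hd xs) x \<and> R\<^sup>*\<^sup>* x (last xs)"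
  using assms
proof (induction R xs arbitrary: x rule: successively.induct)
  case (3 R a b xs)
  from "3.prems"(1) have ab: "R a b" and succ: "successively R (b # xs)"
    by simp_all
  have hd_last: "R\<^sup>*\<^sup>* b (last (b # xs))"
    using "3.IH"[OF succ, of b] by simp
  show ?case
  proof (cases "x = a")
    case True
    then show ?thesis
      using ab hd_last by (auto intro: converse_rtranclp_into_rtranclp)
  next
    case False
    then have "x \<in> set (b # xs)"
      using "3.prems"(2) by simp
    from "3.IH"[OF succ this] show ?thesis
      using ab by (auto intro: converse_rtranclp_into_rtranclp)
  qed
qed auto

text \<open>A discrete intermediate value argument: each transition adds at most one selected index,
  so no length is skipped.\<close>

lemma ex_state_with_length_selected:
  assumes "successively (greedy_step I f K B) \<sigma>" "\<sigma> \<noteq> []"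
    and "length (selected (hd \<sigma>)) \<le> i" "i \<le> length (selected (last \<sigma>))"
  shows "\<exists>s \<in> set \<sigma>. length (selected s) = i"
  using assms
proof (induction \<sigma> rule: induct_list012)
  case (3 a b \<sigma>)
  show ?case
  proof (cases "length (selected a) = i")
    case False
    then have "length (selected b) \<le> i"
      using 3 selected_step_cases[of I f K B a b] by auto
    then show ?thesis
      using 3 by auto
  qed auto
qed auto

lemma run_bound_eq_final_bound:
  assumes run: "greedy_run I f K B \<sigma>" and i: "i \<in> {1..length (run_selected \<sigma>)}"
  shows "run_bound \<sigma> i = bound (last \<sigma>) (run_selected \<sigma> ! (i - 1))"
proof -
  have succ: "successively (greedy_step I f K B) \<sigma>" and "\<sigma> \<noteq> []"
    and hd: "selected (hd \<sigma>) = []"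
    using run by (auto simp: greedy_run_def initial_state_def)
  then have "\<exists>s \<in> set \<sigma>. length (selected s) = i"
    using i by (intro ex_state_with_length_selected[OF succ]) (auto simp: run_selected_def)
  \<comment> \<open>\<open>state_after_step\<close> applies \<open>the\<close> to this search, so
    its value is meaningful only once the search is known to succeed.\<close>
  then have "List.find (\<lambda>s. length (selected s) = i) \<sigma> \<noteq> None"
    by (auto simp: find_None_iff)
  then obtain r where find: "List.find (\<lambda>s. length (selected s) = i) \<sigma> = Some r"
    by blast
  then have r: "r \<in> set \<sigma>" "length (selected r) = i"
    by (auto simp: find_Some_iff)
  then have steps: "(greedy_step I f K B)\<^sup>*\<^sup>* r (last \<sigma>)"
    using successively_imp_rtranclp[OF succ] by blast
  \<comment> \<open>The state \<open>r\<close> already contains the \<open>i\<close>-th selected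
    index as its last entry, and later selections only append; its bound is therefore frozen from
    \<open>r\<close> on.\<close>
  have "run_selected \<sigma> ! (i - 1) = selected r ! (i - 1)"
    using selected_steps_prefix[OF steps] r(2) i
    by (auto simp: run_selected_def prefix_def nth_append)
  then have "run_selected \<sigma> ! (i - 1) \<in> set (selected r)"
    using r(2) i by auto
  then show ?thesis
    using bound_steps_selected[OF steps] find by (simp add: run_bound_def state_after_step_def)
qed

theorem theorem1:
  fixes c :: "'q \<Rightarrow> 'i set \<Rightarrow> real" and q :: 'q and I :: "'i set"
    and K B t :: nat and \<sigma> :: "'i search_state list" and s :: "'i search_state"
    and zs' :: "'i list"
  assumes "finite I"
    and "\<forall>C \<subseteq> I. c q C \<ge> 0"
    and "antimono_on (Pow I) (c q)"
    and "submodular_cost I (c q)"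
    and "greedy_run I (c q) K B \<sigma>"
    and "t < B"
    and "s \<in> set \<sigma>" and "length (calls s) = t"
    and "simulated_greedy I K (bound s) zs'"
  shows "(\<Sum>j = 1..K. simulated_bound (bound s) zs' j)
           \<ge> (\<Sum>i = 1..length (run_selected \<sigma>). run_bound \<sigma> i)
       \<and> cost_lower_bound (c q) K (bound s) zs' \<le> c q (returned_configuration \<sigma>)"
proof -
  have succ: "successively (greedy_step I (c q) K B) \<sigma>" and hd: "hd \<sigma> = initial_state I (c q)"
    using assms(5) by (auto simp: greedy_run_def)
  let ?C = "returned_configuration \<sigma>"
  \<comment> \<open>The run splits at \<open>s\<close>: the part before yields the invariant at
    \<open>s\<close>, and along the part after the bounds can only decrease.\<close>
  have from_s: "(greedy_step I (c q) K B)\<^sup>*\<^sup>* s (last \<sigma>)"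
    and inv_s: "search_invariant I (c q) K s"
    using successively_imp_rtranclp[OF succ assms(7)] hd
      search_invariant_steps[OF assms(3,4)] search_invariant_initial[OF assms(1,2)] by auto
  have inv: "search_invariant I (c q) K (last \<sigma>)"
    by (rule search_invariant_steps[OF assms(3,4) from_s inv_s])
  have C: "?C \<subseteq> I" "card ?C \<le> K" and dist: "distinct (run_selected \<sigma>)"
    using inv by (auto simp: search_invariant_def returned_configuration_def run_selected_def
        distinct_card)
  have run_sum: "(\<Sum>i = 1..length (run_selected \<sigma>). run_bound \<sigma> i) = sum (bound (last \<sigma>)) ?C"
  proof -
    have "(\<Sum>i = 1..length (run_selected \<sigma>). run_bound \<sigma> i)
        = (\<Sum>i = 1..length (run_selected \<sigma>). bound (last \<sigma>) (run_selected \<sigma> ! (i - 1)))"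
      by (intro sum.cong refl run_bound_eq_final_bound[OF assms(5)])
    also have "\<dots> = (\<Sum>i<length (run_selected \<sigma>). bound (last \<sigma>) (run_selected \<sigma> ! i))"
      by (simp add: sum.atLeast1_atMost_eq)
    also have "\<dots> = sum (bound (last \<sigma>)) ?C"
      using dist by (simp add: returned_configuration_def sum.distinct_set_conv_list
          sum_list_sum_nth atLeast0LessThan)
    finally show ?thesis .
  qed
  also have "\<dots> \<le> sum (bound s) ?C"
    using C(1) by (intro sum_mono bound_steps_le[OF assms(3,4) from_s inv_s]) auto
  also have "\<dots> \<le> (\<Sum>j = 1..K. simulated_bound (bound s) zs' j)"
    using inv_s C by (intro sum_le_sum_simulated_bound[OF assms(9)])
      (auto simp: search_invariant_def returned_configuration_def)
  finally have le: "(\<Sum>i = 1..length (run_selected \<sigma>). run_bound \<sigma> i)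
      \<le> (\<Sum>j = 1..K. simulated_bound (bound s) zs' j)" .
  \<comment> \<open>The telescoped clause at the final state turns the comparison of sums into the
    lower bound on the cost.\<close>
  moreover have "c q {} - c q ?C \<le> sum (bound (last \<sigma>)) ?C"
    using inv by (simp add: search_invariant_def returned_configuration_def run_selected_def)
  ultimately show ?thesis
    using run_sum by (simp add: cost_lower_bound_def)
qed

end
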